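(* With threshold payments, the mechanism Random-TM$(0.5,A,B)$ is (universally) truthful, budget feasible, and has approximation ratio $5$, i.e. $5\,E[v(S)]\ge opt(A,B)$ where $S$ is its (random) winning set. Moreover, under the large market assumption, the mechanism Greedy-TM$(0.5,A,B)$ with threshold payments is truthful, budget feasible and has approximation ratio $3$ (in the large market limit $\theta\to 0$).
   Context: Setting. A buyer with budget $B>0$ faces a finite set $A$ of $n$ sellers. Seller $i$ owns one item (also called $i$) and has a private cost $c_i\ge 0$; his utility when selling at payment $p_i$ is $p_i-c_i$. The buyer's value $v:2^A\to\mathbb{R}_{\ge 0}$ is monotone non-decreasing and submodular, with $v(\{i\})>0$ for all $i$. Write $v(i)=v(\{i\})$, $m_i(S)=v(S\cup\{i\})-v(S)$, $c(S)=\sum_{i\in S}c_i$, and $opt(A,B)=\max\{v(S):S\subseteq A,\ c(S)\le B\}$. Mechanisms. A deterministic allocation rule $f$ maps each declared cost vector $c$ to a winning set $f(c)\subseteq A$. It is monotone if $i\in f(c_i,c_{-i})$ and $c_i'\le c_i$ imply $i\in f(c_i',c_{-i})$. Threshold payments: a winner $i$ is paid $p_i=\inf\{b: i\notin f(b,c_{-i})\}$, losers are paid $0$. A deterministic mechanism is truthful if declaring the true cost is always a dominant strategy for each seller; a randomized mechanism is universally truthful if it is a randomization over truthful deterministic mechanisms. It is budget feasible if for every cost vector (and every realization of the randomness) the total payment is at most $B$. Greedy order. $S_0=\emptyset$ and $S_i=S_{i-1}\cup\{\arg\max_{j\in A\setminus S_{i-1}} m_j(S_{i-1})/c_j\}$,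 ties broken by a fixed order on sellers; the ratio is $0$ if $m_j(S_{i-1})=0$ and $+\infty$ if $c_j=0<m_j(S_{i-1})$. Items are renamed so that $S_i\setminus S_{i-1}=\{i\}$. Greedy-TM$(\gamma,A,B)$: start with $k=1$; while $k\le |A|$ and $\frac{c_k}{m_k(S_{k-1})}\le\gamma\frac{B}{v(S_k)}$ increase $k$ by one (the condition is considered false if $m_k(S_{k-1})=0$); return $S_{k-1}$. Random-TM$(\gamma,A,B)$: replace $A$ by $\{i\in A:c_i\le B\}$ (return $\emptyset$ if this is empty); let $i^*\in\arg\max_{i\in A}v(i)$; with probability $\frac{\gamma+1}{\gamma+2}$ return Greedy-TM$(\gamma,A,B)$, otherwise return $\{i^*\}$. Large market assumption. Let $\theta=\max_{i\in A}v(i)/opt(A,B)$ (with $opt(A,B)>0$). "Approximation ratio $\rho$ in the large market limit" means: for every $\varepsilon>0$ there is $\theta_0>0$ such that on every instance with $\theta\le\theta_0$ the winning set $S$ satisfies $(\rho+\varepsilon)v(S)\ge opt(A,B)$. *)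

theory Defs
  imports
    "HOL-Probability.Probability_Mass_Function"
    "HOL-Library.Extended_Real"
    "HOL-Library.While_Combinator"
begin

text \<open>
  Sellers have a type of class \<open>linorder\<close>; its order is the fixed order used for breaking ties.
  Cost vectors are functions \<open>'a \<Rightarrow> real\<close> of which only the values on the finite set \<open>A\<close> matter.
\<close>

subsection \<open>The market\<close>

definition submodular_on :: "'a set \<Rightarrow> ('a set \<Rightarrow> real) \<Rightarrow> bool" where
  "submodular_on A v \<longleftrightarrow> (\<forall>S\<subseteq>A. \<forall>T\<subseteq>A. v (S \<union> T) + v (S \<inter> T) \<le> v S + v T)"

text \<open>The valuation is not assumed to be normalized: \<open>v {} > 0\<close> is allowed.\<close>

definition procurement_instance :: "'a set \<Rightarrow> real \<Rightarrow> ('a set \<Rightarrow> real) \<Rightarrow> bool" where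
  "procurement_instance A B v \<longleftrightarrow>
     finite A \<and> 0 < B \<and> (\<forall>S\<subseteq>A. 0 \<le> v S) \<and> mono_on (Pow A) v \<and> submodular_on A v \<and>
     (\<forall>i\<in>A. 0 < v {i})"

definition cost_vector :: "'a set \<Rightarrow> ('a \<Rightarrow> real) \<Rightarrow> bool" where
  "cost_vector A c \<longleftrightarrow> (\<forall>i\<in>A. 0 \<le> c i)"

definition marginal :: "('a set \<Rightarrow> real) \<Rightarrow> 'a \<Rightarrow> 'a set \<Rightarrow> real" where
  "marginal v i S = v (S \<union> {i}) - v S"

definition opt :: "'a set \<Rightarrow> real \<Rightarrow> ('a set \<Rightarrow> real) \<Rightarrow> ('a \<Rightarrow> real) \<Rightarrow> real" where
  "opt A B v c = Max {v S | S. S \<subseteq> A \<and> sum c S \<le> B}"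

definition market_theta :: "'a set \<Rightarrow> real \<Rightarrow> ('a set \<Rightarrow> real) \<Rightarrow> ('a \<Rightarrow> real) \<Rightarrow> real" where
  "market_theta A B v c = Max ((\<lambda>i. v {i}) ` A) / opt A B v c"

subsection \<open>Mechanisms\<close>

type_synonym 'a allocation = "('a \<Rightarrow> real) \<Rightarrow> 'a set"
type_synonym 'a payment = "('a \<Rightarrow> real) \<Rightarrow> 'a \<Rightarrow> ereal"
type_synonym 'a mechanism = "'a allocation \<times> 'a payment"

text \<open>
  Payments are extended reals, so that the infimum is \<open>\<infinity>\<close> for a seller who wins with every bid.
\<close>

definition threshold_payment :: "'a allocation \<Rightarrow> 'a payment" where
  "threshold_payment f c i =
     (if i \<in> f c then (INF b\<in>{b. 0 \<le> b \<and> i \<notin> f (c(i := b))}. ereal b) else 0)"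

definition with_thresholds :: "'a allocation \<Rightarrow> 'a mechanism" where
  "with_thresholds f = (f, threshold_payment f)"

text \<open>Utility of seller \<open>i\<close> with true cost \<open>t\<close> when the declared cost vector is \<open>c\<close>.\<close>

definition utility :: "'a mechanism \<Rightarrow> 'a \<Rightarrow> real \<Rightarrow> ('a \<Rightarrow> real) \<Rightarrow> ereal" where
  "utility M i t c = snd M c i - (if i \<in> fst M c then ereal t else 0)"

definition truthful :: "'a set \<Rightarrow> 'a mechanism \<Rightarrow> bool" where
  "truthful A M \<longleftrightarrow>
     (\<forall>c. cost_vector A c \<longrightarrow>
       (\<forall>i\<in>A. \<forall>b\<ge>0. utility M i (c i) (c(i := b)) \<le> utility M i (c i) c))"

definition budget_feasible :: "'a set \<Rightarrow> real \<Rightarrow> 'a mechanism \<Rightarrow> bool" where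
  "budget_feasible A B M \<longleftrightarrow>
     (\<forall>c. cost_vector A c \<longrightarrow> (\<Sum>i\<in>A. snd M c i) \<le> ereal B)"

text \<open>
  A randomized mechanism is a distribution over deterministic ones; the randomness does not
  depend on the declared costs.
\<close>

definition universally_truthful :: "'a set \<Rightarrow> 'a mechanism pmf \<Rightarrow> bool" where
  "universally_truthful A R \<longleftrightarrow> (\<forall>M\<in>set_pmf R. truthful A M)"

definition universally_budget_feasible :: "'a set \<Rightarrow> real \<Rightarrow> 'a mechanism pmf \<Rightarrow> bool" where
  "universally_budget_feasible A B R \<longleftrightarrow> (\<forall>M\<in>set_pmf R. budget_feasible A B M)"

definition expected_value :: "('a set \<Rightarrow> real) \<Rightarrow> 'a mechanism pmf \<Rightarrow> ('a \<Rightarrow> real) \<Rightarrow> real" where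
  "expected_value v R c = measure_pmf.expectation R (\<lambda>M. v (fst M c))"

subsection \<open>The greedy order\<close>

definition greedy_ratio ::
  "('a set \<Rightarrow> real) \<Rightarrow> ('a \<Rightarrow> real) \<Rightarrow> 'a set \<Rightarrow> 'a \<Rightarrow> ereal" where
  "greedy_ratio v c S j =
     (if marginal v j S = 0 then 0
      else if c j = 0 then \<infinity>
      else ereal (marginal v j S / c j))"

definition greedy_next ::
  "'a::linorder set \<Rightarrow> ('a set \<Rightarrow> real) \<Rightarrow> ('a \<Rightarrow> real) \<Rightarrow> 'a set \<Rightarrow> 'a" where
  "greedy_next A v c S =
     Min {j \<in> A - S. \<forall>k \<in> A - S. greedy_ratio v c S k \<le> greedy_ratio v c S j}"

primrec greedy_set ::
  "'a::linorder set \<Rightarrow> ('a set \<Rightarrow> real) \<Rightarrow> ('a \<Rightarrow> real) \<Rightarrow> nat \<Rightarrow> 'a set" where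
  "greedy_set A v c 0 = {}"
| "greedy_set A v c (Suc i) =
     (if A \<subseteq> greedy_set A v c i then greedy_set A v c i
      else greedy_set A v c i \<union> {greedy_next A v c (greedy_set A v c i)})"

text \<open>The \<open>k\<close>-th item in the greedy order, for \<open>1 \<le> k \<le> card A\<close>.\<close>

definition greedy_item ::
  "'a::linorder set \<Rightarrow> ('a set \<Rightarrow> real) \<Rightarrow> ('a \<Rightarrow> real) \<Rightarrow> nat \<Rightarrow> 'a" where
  "greedy_item A v c k = greedy_next A v c (greedy_set A v c (k - 1))"

subsection \<open>Greedy-TM and Random-TM\<close>

definition greedy_tm_cond ::
  "real \<Rightarrow> 'a::linorder set \<Rightarrow> real \<Rightarrow> ('a set \<Rightarrow> real) \<Rightarrow> ('a \<Rightarrow> real) \<Rightarrow> nat \<Rightarrow> bool" where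
  "greedy_tm_cond \<gamma> A B v c k \<longleftrightarrow>
     k \<le> card A \<and>
     (let i = greedy_item A v c k; m = marginal v i (greedy_set A v c (k - 1))
      in m \<noteq> 0 \<and> c i / m \<le> \<gamma> * (B / v (greedy_set A v c k)))"

definition greedy_tm ::
  "real \<Rightarrow> 'a::linorder set \<Rightarrow> real \<Rightarrow> ('a set \<Rightarrow> real) \<Rightarrow> 'a allocation" where
  "greedy_tm \<gamma> A B v c = greedy_set A v c (while (greedy_tm_cond \<gamma> A B v c) Suc 1 - 1)"

definition best_single :: "'a::linorder set \<Rightarrow> ('a set \<Rightarrow> real) \<Rightarrow> 'a" where
  "best_single A v = Min {i \<in> A. \<forall>j\<in>A. v {j} \<le> v {i}}"

text \<open>The allocation of Random-TM for a fixed outcome of its coin flip.\<close>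

definition random_tm_outcome ::
  "real \<Rightarrow> 'a::linorder set \<Rightarrow> real \<Rightarrow> ('a set \<Rightarrow> real) \<Rightarrow> bool \<Rightarrow> 'a allocation" where
  "random_tm_outcome \<gamma> A B v coin c =
     (let A' = {i \<in> A. c i \<le> B}
      in if A' = {} then {}
         else if coin then greedy_tm \<gamma> A' B v c
         else {best_single A' v})"

definition random_tm ::
  "real \<Rightarrow> 'a::linorder set \<Rightarrow> real \<Rightarrow> ('a set \<Rightarrow> real) \<Rightarrow> 'a allocation pmf" where
  "random_tm \<gamma> A B v =
     map_pmf (random_tm_outcome \<gamma> A B v) (bernoulli_pmf ((\<gamma> + 1) / (\<gamma> + 2)))"

end

theory Submission
  imports Defs
begin

text \<open>
  Lowering the bid of a seller moves him forward in the greedy order and leaves the prefix before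
  him unchanged; the stopping condition at the earlier position is weaker, so the allocation is
  monotone and thresholds make it truthful.

  For the budget, let \<open>S\<close> be the winning set and let \<open>m\<close> be the marginal of a winner \<open>i\<close> when he is
  selected. If \<open>i\<close> still wins with a higher bid \<open>b\<close> after a longer prefix \<open>T\<close>, then
  \<open>b v(T \<union> {i}) \<le> \<gamma> B m\<close> by the stopping condition, and \<open>b (v(S) - v(T \<union> {i})) \<le> m c(S) \<le> \<gamma> B m\<close>
  because \<open>i\<close> is preferred to the rest of \<open>S\<close> at \<open>T\<close>. Hence \<open>b \<le> 2 \<gamma> B m / v(S)\<close>, and the marginals
  add up to at most \<open>v(S)\<close>; so \<open>\<gamma> \<le> 1/2\<close> suffices.

  For the approximation, the first rejected item \<open>k\<close> has the best ratio with respect to \<open>S\<close>, so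
  adding the optimum to \<open>S\<close> gains at most \<open>B m\<^sub>k(S) / c\<^sub>k < v(S \<union> {k}) / \<gamma> \<le> (v(S) + v(k)) / \<gamma>\<close>.
\<close>

section \<open>Truthfulness of monotone rules with threshold payments\<close>

text \<open>The price \<open>p\<close> offered to a winner does not depend on his own bid. By
  monotonicity every losing bid exceeds a winning true cost, so \<open>p\<close> is at least that
  cost; a losing true cost is itself one of the bids under the infimum, so a lie that wins pays at
  most the cost.\<close>

lemma truthful_with_thresholds:
  assumes mono: "\<And>c i b. cost_vector A c \<Longrightarrow> i \<in> A \<Longrightarrow> i \<in> f c \<Longrightarrow> 0 \<le> b \<Longrightarrow> b \<le> c i \<Longrightarrow> i \<in> f (c(i := b))"
  shows "truthful A (with_thresholds f)"
  unfolding truthful_def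
proof (intro allI impI ballI)
  fix c :: "'a \<Rightarrow> real" and i b
  assume c: "cost_vector A c" and i: "i \<in> A" and b: "0 \<le> (b::real)"
  define p where "p = (INF b\<in>{b. 0 \<le> b \<and> i \<notin> f (c(i := b))}. ereal b)"
  have ci: "0 \<le> c i" using c i by (auto simp: cost_vector_def)
  have pay: "threshold_payment f (c(i := b)) i = p" if "i \<in> f (c(i := b))" for b
    using that by (simp add: threshold_payment_def p_def)
  have pay0: "threshold_payment f c i = p" if "i \<in> f c"
    using pay[of "c i"] that by simp
  have win: "ereal (c i) \<le> p" if "i \<in> f c"
    unfolding p_def
  proof (rule INF_greatest)
    fix b assume "b \<in> {b. 0 \<le> b \<and> i \<notin> f (c(i := b))}"
    then show "ereal (c i) \<le> ereal b"
      using mono[OF c i that, of b] by force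
  qed
  have lose: "p \<le> ereal (c i)" if "i \<notin> f c"
    unfolding p_def by (rule INF_lower) (use that ci in auto)
  show "utility (with_thresholds f) i (c i) (c(i := b)) \<le> utility (with_thresholds f) i (c i) c"
  proof (cases "i \<in> f c"; cases "i \<in> f (c(i := b))")
    assume "i \<in> f c" "i \<in> f (c(i := b))"
    then show ?thesis by (simp add: utility_def with_thresholds_def pay pay0)
  next
    assume a: "i \<in> f c" "i \<notin> f (c(i := b))"
    have "0 \<le> p - ereal (c i)" using win[OF a(1)] by (simp add: ereal_diff_positive)
    with a show ?thesis
      by (simp add: utility_def with_thresholds_def pay0) (simp add: threshold_payment_def zero_ereal_def)
  next
    assume a: "i \<notin> f c" "i \<in> f (c(i := b))"
    have "p - ereal (c i) \<le> 0" using lose[OF a(1)] by (cases p) auto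
    with a show ?thesis
      by (simp add: utility_def with_thresholds_def pay) (simp add: threshold_payment_def zero_ereal_def)
  next
    assume "i \<notin> f c" "i \<notin> f (c(i := b))"
    then show ?thesis by (simp add: utility_def with_thresholds_def threshold_payment_def)
  qed
qed

lemma cost_vector_upd: "cost_vector A c \<Longrightarrow> 0 \<le> b \<Longrightarrow> cost_vector A (c(i := b))"
  by (simp add: cost_vector_def)

section \<open>The loop of Greedy-TM\<close>

text \<open>Trades the loop for the number \<open>N\<close> of accepted items; the counter starts at
  1 and so ends at \<open>N + 1\<close>. The loop halts because its condition includes
  \<open>k \<le> card A\<close>.\<close>

lemma greedy_tm_stop:
  assumes "finite A"
  obtains N where "N \<le> card A" "greedy_tm \<gamma> A B v c = greedy_set A v c N"
    "\<And>n. n < N \<Longrightarrow> greedy_tm_cond \<gamma> A B v c (Suc n)" "\<not> greedy_tm_cond \<gamma> A B v c (Suc N)"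
proof -
  define cond where "cond = greedy_tm_cond \<gamma> A B v c"
  define k where "k = while cond Suc 1"
  have le: "cond k \<Longrightarrow> k \<le> card A" for k by (simp add: cond_def greedy_tm_cond_def)
  have "1 \<le> k \<and> k \<le> card A + 1 \<and> (\<forall>n. Suc n < k \<longrightarrow> cond (Suc n)) \<and> \<not> cond k"
    unfolding k_def
  proof (rule while_rule[where r = "Wellfounded.measure (\<lambda>k. card A + 1 - k)" and
        P = "\<lambda>k. 1 \<le> k \<and> k \<le> card A + 1 \<and> (\<forall>n. Suc n < k \<longrightarrow> cond (Suc n))"])
    fix k assume "1 \<le> k \<and> k \<le> card A + 1 \<and> (\<forall>n. Suc n < k \<longrightarrow> cond (Suc n))" "cond k"
    then show "1 \<le> Suc k \<and> Suc k \<le> card A + 1 \<and> (\<forall>n. Suc n < Suc k \<longrightarrow> cond (Suc n))"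
      using le[of k] by (metis Suc_eq_plus1 Suc_le_mono le_SucI less_antisym less_Suc_eq)
  next
    fix k assume "cond k"
    then show "(Suc k, k) \<in> Wellfounded.measure (\<lambda>k. card A + 1 - k)"
      using le[of k] by simp
  qed auto
  then show ?thesis
    by (intro that[of "k - 1"]) (auto simp: greedy_tm_def k_def cond_def)
qed

section \<open>Submodular valuations and marginals\<close>

locale procurement =
  fixes A :: "'a::linorder set" and B :: real and v :: "'a set \<Rightarrow> real"
  assumes inst: "procurement_instance A B v"
begin

lemma fin: "finite A" and B_pos: "0 < B" and v_nonneg: "S \<subseteq> A \<Longrightarrow> 0 \<le> v S"
  and v_sub: "S \<subseteq> A \<Longrightarrow> T \<subseteq> A \<Longrightarrow> v (S \<union> T) + v (S \<inter> T) \<le> v S + v T"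
  and v_mono: "S \<subseteq> T \<Longrightarrow> T \<subseteq> A \<Longrightarrow> v S \<le> v T"
  and v_single: "i \<in> A \<Longrightarrow> 0 < v {i}"
  using inst by (auto simp: procurement_instance_def submodular_on_def mono_on_def)

lemma v_pos: "S \<subseteq> A \<Longrightarrow> i \<in> S \<Longrightarrow> 0 < v S"
  using v_single[of i] v_mono[of "{i}" S] by fastforce

lemma marginal_nonneg: "S \<subseteq> A \<Longrightarrow> i \<in> A \<Longrightarrow> 0 \<le> marginal v i S"
  using v_mono[of S "S \<union> {i}"] by (auto simp: marginal_def)

text \<open>Submodularity for \<open>S \<union> {i}\<close> and \<open>T\<close>, whose intersection
  is \<open>S\<close> unless \<open>i\<close> lies in \<open>T\<close>; in that case the left
  marginal is 0.\<close>

lemma marginal_antimono: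
  assumes "S \<subseteq> T" "T \<subseteq> A" "i \<in> A"
  shows "marginal v i T \<le> marginal v i S"
proof (cases "i \<in> T")
  case True
  then show ?thesis
    using marginal_nonneg[of S i] assms by (simp add: marginal_def insert_absorb)
next
  case False
  then have eq: "(S \<union> {i}) \<union> T = T \<union> {i}" "(S \<union> {i}) \<inter> T = S" and sub: "S \<union> {i} \<subseteq> A"
    using assms by auto
  show ?thesis
    using v_sub[OF sub assms(2), unfolded eq] by (simp add: marginal_def)
qed

text \<open>The marginal at the empty set is \<open>v {i} - v {}\<close>, where \<open>v {}\<close>
  need not be 0 but is nonnegative.\<close>

lemma marginal_le_single: "S \<subseteq> A \<Longrightarrow> i \<in> A \<Longrightarrow> marginal v i S \<le> v {i}"
  using marginal_antimono[of "{}" S i] v_nonneg[of "{}"] by (simp add: marginal_def)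

text \<open>When the items of \<open>T - S\<close> are added to \<open>S\<close> one by one, each
  gains at most its marginal at \<open>S\<close>.\<close>

lemma value_le_marginals:
  assumes "S \<subseteq> A" "T \<subseteq> A"
  shows "v T \<le> v S + (\<Sum>r\<in>T - S. marginal v r S)"
proof -
  have "v (S \<union> X) \<le> v S + (\<Sum>r\<in>X. marginal v r S)" if "X \<subseteq> A" for X
    using finite_subset[OF that fin] that
  proof (induction X)
    case (insert x X)
    have "marginal v x (S \<union> X) \<le> marginal v x S"
      using insert assms by (intro marginal_antimono) auto
    then show ?case using insert by (auto simp: marginal_def)
  qed simp
  from this[of "T - S"] have "v (S \<union> T) \<le> v S + (\<Sum>r\<in>T - S. marginal v r S)"
    using assms by auto
  moreover have "v T \<le> v (S \<union> T)" using assms by (intro v_mono) auto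
  ultimately show ?thesis by simp
qed

section \<open>The greedy choice\<close>

text \<open>The third claim is the tie-breaking rule; it is what determines the choice when a bid
  changes.\<close>

lemma greedy_next_max:
  assumes "S \<subseteq> A" "S \<noteq> A"
  shows "greedy_next A v c S \<in> A - S"
    and "k \<in> A - S \<Longrightarrow> greedy_ratio v c S k \<le> greedy_ratio v c S (greedy_next A v c S)"
    and "j \<in> A - S \<Longrightarrow> (\<And>k. k \<in> A - S \<Longrightarrow> greedy_ratio v c S k \<le> greedy_ratio v c S j)
      \<Longrightarrow> greedy_next A v c S \<le> j"
proof -
  let ?M = "{j \<in> A - S. \<forall>k \<in> A - S. greedy_ratio v c S k \<le> greedy_ratio v c S j}"
  let ?R = "greedy_ratio v c S ` (A - S)"
  have finM: "finite ?M" using fin by auto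
  have "A - S \<noteq> {}" using assms by auto
  then have "Max ?R \<in> ?R" using fin by (intro Max_in) auto
  then obtain j where j: "j \<in> A - S" "Max ?R = greedy_ratio v c S j" by auto
  have "greedy_ratio v c S k \<le> greedy_ratio v c S j" if "k \<in> A - S" for k
    unfolding j(2)[symmetric] using that fin by (intro Max_ge) auto
  then have "?M \<noteq> {}" using j by auto
  then have "greedy_next A v c S \<in> ?M"
    unfolding greedy_next_def using finM by (intro Min_in)
  then show "greedy_next A v c S \<in> A - S"
    and "k \<in> A - S \<Longrightarrow> greedy_ratio v c S k \<le> greedy_ratio v c S (greedy_next A v c S)"
    by auto
  show "greedy_next A v c S \<le> j"
    if "j \<in> A - S" "\<And>k. k \<in> A - S \<Longrightarrow> greedy_ratio v c S k \<le> greedy_ratio v c S j" for j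
    unfolding greedy_next_def using finM that by (intro Min_le) auto
qed

text \<open>The comparison of ratios in product form, so that later uses need no case distinction
  for zero costs or marginals.\<close>

lemma greedy_next_cross:
  assumes c: "cost_vector A c" and S: "S \<subseteq> A" and j: "j \<in> A - S"
  defines "x \<equiv> greedy_next A v c S"
  shows "marginal v j S * c x \<le> marginal v x S * c j"
proof -
  have neq: "S \<noteq> A" using j by auto
  note x = greedy_next_max[OF S neq, where c = c, folded x_def]
  have nn: "0 \<le> marginal v x S" "0 \<le> marginal v j S" "0 \<le> c x" "0 \<le> c j"
    using x(1) j S c by (auto simp: marginal_nonneg cost_vector_def)
  have le: "greedy_ratio v c S j \<le> greedy_ratio v c S x" by (rule x(2)[OF j])
  show ?thesis
  proof (cases "marginal v j S = 0 \<or> c x = 0")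
    case True
    then show ?thesis using nn by auto
  next
    case False
    \<comment> \<open>The ratio of \<open>j\<close> is positive and that of \<open>x\<close> is
      finite, so \<open>x\<close> has nonzero marginal and \<open>j\<close> has nonzero
      cost.\<close>
    then have "0 < greedy_ratio v c S j" using nn by (auto simp: greedy_ratio_def)
    with le have "marginal v x S \<noteq> 0" by (auto simp: greedy_ratio_def split: if_splits)
    with le False have "c j \<noteq> 0" "marginal v j S / c j \<le> marginal v x S / c x"
      by (auto simp: greedy_ratio_def split: if_splits)
    then show ?thesis using nn False by (simp add: field_simps)
  qed
qed

text \<open>Covers what \<open>greedy_next_cross\<close> misses: if the chosen item has cost 0, the
  product inequality says nothing about \<open>marginal v j S\<close>. A nonzero marginal would give
  \<open>j\<close> a positive ratio, against the ratio 0 of the chosen item.\<close>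

lemma marginal_eq_0_if_greedy_next_0:
  assumes c: "cost_vector A c" and S: "S \<subseteq> A" and j: "j \<in> A - S"
    and 0: "marginal v (greedy_next A v c S) S = 0"
  shows "marginal v j S = 0"
proof (rule ccontr)
  assume "marginal v j S \<noteq> 0"
  then have "0 < greedy_ratio v c S j"
    using marginal_nonneg[of S j] c S j by (auto simp: greedy_ratio_def cost_vector_def)
  moreover have "greedy_ratio v c S j \<le> greedy_ratio v c S (greedy_next A v c S)"
    using j S by (intro greedy_next_max(2)) auto
  ultimately show False using 0 by (simp add: greedy_ratio_def)
qed

text \<open>A lower bid can only raise the ratio of \<open>i\<close> and leaves the others alone. If
  \<open>i\<close> is still not chosen, the old and the new choice each maximize both the old and
  the new ratios, so tie-breaking makes them equal.\<close>

lemma greedy_next_lower: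
  assumes c: "cost_vector A c" and b: "0 \<le> b" "b \<le> c i" and S: "S \<subseteq> A" "S \<noteq> A"
    and ne: "greedy_next A v (c(i := b)) S \<noteq> i"
  shows "greedy_next A v (c(i := b)) S = greedy_next A v c S"
proof -
  let ?c = "c(i := b)"
  define x y where "x = greedy_next A v c S" and "y = greedy_next A v ?c S"
  note X = greedy_next_max[OF S, where c = c, folded x_def]
  note Y = greedy_next_max[OF S, where c = ?c, folded y_def]
  have eq: "greedy_ratio v ?c S k = greedy_ratio v c S k" if "k \<noteq> i" for k
    using that by (simp add: greedy_ratio_def)
  have le: "greedy_ratio v c S k \<le> greedy_ratio v ?c S k" if "k \<in> A - S" for k
    using that b marginal_nonneg[of S k] S
    by (auto simp: greedy_ratio_def frac_le)
  have yi: "y \<noteq> i" using ne by (simp add: y_def)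
  have "x \<le> y"
  proof (rule X(3))
    fix k assume k: "k \<in> A - S"
    show "greedy_ratio v c S k \<le> greedy_ratio v c S y"
      using le[OF k] Y(2)[OF k] eq[OF yi] by simp
  qed (use Y in simp)
  moreover have "y \<le> x"
  proof (rule Y(3))
    fix k assume k: "k \<in> A - S"
    show "greedy_ratio v ?c S k \<le> greedy_ratio v ?c S x"
      using X(2)[OF Y(1)] Y(2)[OF k] eq[OF yi] le[OF X(1)] by simp
  qed (use X in simp)
  ultimately show ?thesis by (simp add: x_def y_def)
qed

section \<open>The greedy sequence for fixed costs\<close>

context
  fixes c :: "'a \<Rightarrow> real"
  assumes c: "cost_vector A c"
begin

text \<open>Counts from 0: this is the item added to the set of \<open>n\<close> items, which the
  mechanism numbers \<open>n + 1\<close>.\<close>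

abbreviation "item n \<equiv> greedy_next A v c (greedy_set A v c n)"

lemma greedy_set_subset: "greedy_set A v c n \<subseteq> A"
proof (induction n)
  case (Suc n)
  then show ?case using greedy_next_max(1)[OF Suc] by auto
qed simp

lemma card_greedy_set: "n \<le> card A \<Longrightarrow> card (greedy_set A v c n) = n"
proof (induction n)
  case (Suc n)
  then have "\<not> A \<subseteq> greedy_set A v c n"
    using greedy_set_subset[of n] by auto
  moreover from this have "item n \<notin> greedy_set A v c n"
    using greedy_next_max(1)[OF greedy_set_subset[of n]] by auto
  ultimately show ?case
    using Suc finite_subset[OF greedy_set_subset fin] by simp
qed simp

lemma greedy_set_ne: "n < card A \<Longrightarrow> greedy_set A v c n \<noteq> A"
  using card_greedy_set[of n] by auto

lemma greedy_set_Suc: "n < card A \<Longrightarrow> greedy_set A v c (Suc n) = greedy_set A v c n \<union> {item n}"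
  using greedy_set_ne[of n] greedy_set_subset[of n] by auto

lemma item_in: "n < card A \<Longrightarrow> item n \<in> A - greedy_set A v c n"
  using greedy_next_max(1)[OF greedy_set_subset greedy_set_ne] by blast

lemma greedy_set_mono: "m \<le> n \<Longrightarrow> greedy_set A v c m \<subseteq> greedy_set A v c n"
  by (rule lift_Suc_mono_le) auto

lemma greedy_set_image: "n \<le> card A \<Longrightarrow> greedy_set A v c n = item ` {..<n}"
proof (induction n)
  case (Suc n)
  then show ?case by (simp add: greedy_set_Suc lessThan_Suc del: greedy_set.simps(2))
qed simp

lemma greedy_set_full: "greedy_set A v c (card A) = A"
  using card_greedy_set[of "card A"] greedy_set_subset[of "card A"] fin
  by (simp add: card_subset_eq)

lemma inj_item: "inj_on item {..<card A}"
proof (rule linorder_inj_onI)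
  fix m n assume "m < n" "m \<in> {..<card A}" "n \<in> {..<card A}"
  then show "item m \<noteq> item n"
    using item_in[of n] greedy_set_image[of n] by (metis DiffD2 imageI lessThan_iff less_imp_le)
qed auto

lemma sum_greedy_set:
  assumes "n \<le> card A"
  shows "(\<Sum>i\<in>greedy_set A v c n. f i) = (\<Sum>k<n. f (item k))"
proof -
  have "inj_on item {..<n}" using inj_item assms by (auto intro: inj_on_subset)
  then show ?thesis unfolding greedy_set_image[OF assms] by (simp add: sum.reindex)
qed

lemma sum_marginals:
  assumes "n \<le> card A"
  shows "(\<Sum>k<n. marginal v (item k) (greedy_set A v c k)) = v (greedy_set A v c n) - v {}"
  using assms
proof (induction n)
  case (Suc n)
  then show ?case by (simp add: greedy_set_Suc marginal_def del: greedy_set.simps(2))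
qed simp

section \<open>Accepted items and their costs\<close>

text \<open>The set of \<open>n + 1\<close> items contains \<open>item n\<close>, so its value is
  positive, and marginals are nonnegative; hence both denominators can be cleared.\<close>

lemma cond_iff:
  assumes n: "n < card A"
  shows "greedy_tm_cond \<gamma> A B v c (Suc n) \<longleftrightarrow>
    0 < marginal v (item n) (greedy_set A v c n) \<and>
    c (item n) * v (greedy_set A v c (Suc n)) \<le> \<gamma> * B * marginal v (item n) (greedy_set A v c n)"
proof -
  have "0 < v (greedy_set A v c (Suc n))"
    using v_pos[OF greedy_set_subset, of "item n" "Suc n"] greedy_set_Suc[OF n] by simp
  moreover have "0 \<le> marginal v (item n) (greedy_set A v c n)"
    using item_in[OF n] by (intro marginal_nonneg greedy_set_subset) auto
  ultimately show ?thesis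
    using n by (auto simp: greedy_tm_cond_def greedy_item_def Let_def field_simps simp del: greedy_set.simps(2))
qed

lemma cond_le_card: "greedy_tm_cond \<gamma> A B v c (Suc n) \<Longrightarrow> n < card A"
  by (simp add: greedy_tm_cond_def)

text \<open>The ratios are decreasing along the greedy order, so the bound of the last winner applies to
  all winners.\<close>

lemma winner_cost:
  assumes cond: "\<And>n. n < N \<Longrightarrow> greedy_tm_cond \<gamma> A B v c (Suc n)" and n: "n < N"
  shows "c (item n) * v (greedy_set A v c N) \<le> \<gamma> * B * marginal v (item n) (greedy_set A v c n)"
proof -
  obtain l where l: "N = Suc l" "n \<le> l" using n by (cases N) auto
  have lA: "l < card A" using cond_le_card[OF cond[of l]] l by simp
  define S T where "S = greedy_set A v c l" and "T = greedy_set A v c n"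
  define m where "m = marginal v (item n) T"
  have last: "0 < marginal v (item l) S" "c (item l) * v (greedy_set A v c N) \<le> \<gamma> * B * marginal v (item l) S"
    using cond[of l] l cond_iff[OF lA] by (auto simp: S_def simp del: greedy_set.simps(2))
  have sub: "T \<subseteq> S" "S \<subseteq> A"
    unfolding S_def T_def using l(2) by (simp_all add: greedy_set_mono greedy_set_subset)
  have xl: "item l \<in> A - S" using item_in[OF lA] by (simp add: S_def)
  have "item n \<in> A" using item_in[of n] l lA by auto
  then have m0: "0 \<le> m" unfolding m_def using sub by (intro marginal_nonneg) auto
  have V: "0 \<le> v (greedy_set A v c N)" by (intro v_nonneg greedy_set_subset)
  have cn: "0 \<le> c (item n)" using c \<open>item n \<in> A\<close> by (auto simp: cost_vector_def)
  \<comment> \<open>\<open>item n\<close> was preferred to \<open>item l\<close> at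
    \<open>T\<close>, and the marginal of \<open>item l\<close> has not grown from \<open>T\<close>
    to \<open>S\<close>.\<close>
  have "marginal v (item l) S * c (item n) \<le> marginal v (item l) T * c (item n)"
    using marginal_antimono[OF sub] xl cn by (intro mult_right_mono) auto
  also have "\<dots> \<le> m * c (item l)"
    unfolding m_def T_def using xl sub by (intro greedy_next_cross[OF c greedy_set_subset]) (auto simp: T_def)
  finally have "marginal v (item l) S * c (item n) * v (greedy_set A v c N) \<le> m * c (item l) * v (greedy_set A v c N)"
    using V by (intro mult_right_mono)
  also have "\<dots> = m * (c (item l) * v (greedy_set A v c N))" by simp
  also have "\<dots> \<le> m * (\<gamma> * B * marginal v (item l) S)"
    using last(2) m0 by (rule mult_left_mono)
  finally have "marginal v (item l) S * (c (item n) * v (greedy_set A v c N)) \<le> marginal v (item l) S * (\<gamma> * B * m)"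
    by (simp add: mult_ac)
  then show ?thesis using last(1) by (simp add: m_def T_def)
qed

text \<open>In the sum of the bounds \<open>winner_cost\<close> the marginals telescope to at most
  the value of the winning set, which is positive and can be cancelled.\<close>

lemma winners_cost:
  assumes cond: "\<And>n. n < N \<Longrightarrow> greedy_tm_cond \<gamma> A B v c (Suc n)" and N: "0 < N" and \<gamma>: "0 \<le> \<gamma>"
  shows "sum c (greedy_set A v c N) \<le> \<gamma> * B"
proof -
  let ?V = "v (greedy_set A v c N)"
  have NA: "N \<le> card A" using cond_le_card[OF cond[of "N - 1"]] N by auto
  have V: "0 < ?V"
    using N greedy_set_image[OF NA] by (intro v_pos[of _ "item 0"] greedy_set_subset imageI) (simp del: greedy_set.simps)
  have "sum c (greedy_set A v c N) * ?V = (\<Sum>n<N. c (item n) * ?V)"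
    by (simp add: sum_greedy_set[OF NA] sum_distrib_right)
  also have "\<dots> \<le> (\<Sum>n<N. \<gamma> * B * marginal v (item n) (greedy_set A v c n))"
    using winner_cost[OF cond] by (intro sum_mono) auto
  also have "\<dots> = \<gamma> * B * (?V - v {})"
    by (simp add: sum_distrib_left[symmetric] sum_marginals[OF NA])
  also have "\<dots> \<le> \<gamma> * B * ?V"
    using \<gamma> B_pos v_nonneg[of "{}"] by (intro mult_left_mono) auto
  finally show ?thesis using V by simp
qed

lemma selection_index:
  assumes "i \<in> greedy_set A v c N" "N \<le> card A"
  obtains n where "n < N" "item n = i" "i \<notin> greedy_set A v c n"
proof -
  obtain n where "n < N" "item n = i" using assms greedy_set_image[OF assms(2)] by auto
  moreover from this have "i \<notin> greedy_set A v c n" using item_in[of n] assms(2) by simp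
  ultimately show thesis by (rule that)
qed

end

section \<open>Monotonicity of the allocation\<close>

text \<open>Iterates \<open>greedy_next_lower\<close>: no choice changes until \<open>i\<close>
  enters. With the two bids in exchanged roles it also serves for a raised bid.\<close>

lemma greedy_set_lower:
  assumes c: "cost_vector A c" and b: "0 \<le> b" "b \<le> c i"
  shows "i \<notin> greedy_set A v (c(i := b)) n \<Longrightarrow> greedy_set A v (c(i := b)) n = greedy_set A v c n"
proof (induction n)
  case (Suc n)
  let ?S = "greedy_set A v c n"
  have "i \<notin> greedy_set A v (c(i := b)) n" 
    using Suc.prems greedy_set_mono[OF cost_vector_upd[OF c b(1)] le_SucI[OF le_refl]] by blast
  then have eq: "greedy_set A v (c(i := b)) n = ?S" by (rule Suc.IH)
  show ?case
  proof (cases "A \<subseteq> ?S")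
    case False
    then have "greedy_next A v (c(i := b)) ?S \<noteq> i" using Suc.prems unfolding greedy_set.simps eq by auto
    then show ?thesis
      using greedy_next_lower[OF c b greedy_set_subset[OF c]] False
      unfolding greedy_set.simps eq by auto
  next
    case True
    then show ?thesis unfolding greedy_set.simps eq by simp
  qed
qed simp

lemma greedy_tm_mono:
  assumes c: "cost_vector A c" and b: "0 \<le> b" "b \<le> c i" and \<gamma>: "0 \<le> \<gamma>"
    and i: "i \<in> greedy_tm \<gamma> A B v c"
  shows "i \<in> greedy_tm \<gamma> A B v (c(i := b))"
proof -
  let ?d = "c(i := b)"
  have d: "cost_vector A ?d" using c b by (simp add: cost_vector_upd)
  obtain N where N: "N \<le> card A" "greedy_tm \<gamma> A B v c = greedy_set A v c N"
    "\<And>n. n < N \<Longrightarrow> greedy_tm_cond \<gamma> A B v c (Suc n)" "\<not> greedy_tm_cond \<gamma> A B v c (Suc N)"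
    by (rule greedy_tm_stop[OF fin, of \<gamma> B v c]) (rule that)
  obtain n where n: "n < N" "item c n = i" "i \<notin> greedy_set A v c n"
    using selection_index[OF c _ N(1)] i N(2) by auto
  have iA: "i \<in> A" using i N(2) greedy_set_subset[OF c] by auto
  \<comment> \<open>Otherwise \<open>greedy_set_lower\<close> would make the two sets of
    \<open>n + 1\<close> items equal, yet \<open>i\<close> is the last one added under
    \<open>c\<close>.\<close>
  have "i \<in> greedy_set A v ?d (Suc n)"
  proof (rule ccontr)
    assume a: "\<not> ?thesis"
    then have "greedy_set A v ?d (Suc n) = greedy_set A v c (Suc n)"
      by (intro greedy_set_lower c b)
    also have "i \<in> \<dots>" using greedy_set_Suc[OF c, of n] n N(1) by simp
    finally show False using a by simp
  qed
  then obtain m where m: "m < Suc n" "item ?d m = i" "i \<notin> greedy_set A v ?d m"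
    by (rule selection_index[OF d]) (use n N(1) in auto)
  have same: "greedy_set A v ?d l = greedy_set A v c l" if "l \<le> m" for l
    using that m(3) greedy_set_mono[OF d that] by (intro greedy_set_lower c b) auto
  have mA: "m < card A" using m n N(1) by simp
  let ?S = "greedy_set A v c m" and ?T = "greedy_set A v c n"
  have ST: "?S \<subseteq> ?T" using m by (intro greedy_set_mono c) auto
  have TA: "?T \<subseteq> A" by (rule greedy_set_subset[OF c])
  have ci: "0 < marginal v i ?T" "c i * v (?T \<union> {i}) \<le> \<gamma> * B * marginal v i ?T"
    using cond_iff[OF c, of n \<gamma>] N(3)[OF n(1)] n N(1) greedy_set_Suc[OF c, of n]
    by (auto simp del: greedy_set.simps(2))
  have mar: "marginal v i ?T \<le> marginal v i ?S" by (intro marginal_antimono ST TA iA)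
  \<comment> \<open>The bid and the set can only shrink and the marginal can only grow, each in
    favour of acceptance.\<close>
  have "b * v (?S \<union> {i}) \<le> c i * v (?T \<union> {i})"
    using b ST TA iA by (intro mult_mono v_mono v_nonneg) auto
  also have "\<dots> \<le> \<gamma> * B * marginal v i ?S"
    using ci(2) mult_left_mono[OF mar, of "\<gamma> * B"] mult_nonneg_nonneg[OF \<gamma> less_imp_le[OF B_pos]]
    by linarith
  finally have last: "greedy_tm_cond \<gamma> A B v ?d (Suc m)"
    using cond_iff[OF d mA, of \<gamma>] greedy_set_Suc[OF d mA] m same[of m] ci(1) mar
    by (auto simp del: greedy_set.simps(2))
  \<comment> \<open>The items before \<open>i\<close> are the same under both vectors and keep their
    bids, so they are accepted as before.\<close>
  have cond: "greedy_tm_cond \<gamma> A B v ?d (Suc l)" if "l \<le> m" for l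
  proof (cases "l = m")
    case False
    then have l: "l < m" "l < N" "Suc l \<le> m" using that m n by auto
    have "item ?d l \<in> greedy_set A v ?d m"
      using greedy_set_image[OF d, of m] l mA by auto
    then have ne: "item ?d l \<noteq> i" using m(3) by auto
    have "greedy_next A v ?d (greedy_set A v c l) = item c l"
      using ne same[of l] greedy_set_ne[OF c, of l] l mA
      by (intro greedy_next_lower c b greedy_set_subset) auto
    then show ?thesis
      using N(3)[OF l(2)] same[of l] same[OF l(3)] l ne
      by (simp add: greedy_tm_cond_def greedy_item_def Let_def del: greedy_set.simps(2))
  qed (use last in simp)
  obtain M where M: "M \<le> card A" "greedy_tm \<gamma> A B v ?d = greedy_set A v ?d M"
    "\<And>n. n < M \<Longrightarrow> greedy_tm_cond \<gamma> A B v ?d (Suc n)" "\<not> greedy_tm_cond \<gamma> A B v ?d (Suc M)"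
    by (rule greedy_tm_stop[OF fin, of \<gamma> B v "?d"]) (rule that)
  \<comment> \<open>The condition fails at \<open>M + 1\<close> but holds up to
    \<open>m + 1\<close>, so the loop gets past \<open>i\<close>.\<close>
  have "Suc m \<le> M" using cond M(4) by (metis not_less_eq_eq)
  then have "greedy_set A v ?d (Suc m) \<subseteq> greedy_set A v ?d M" by (intro greedy_set_mono d)
  then show ?thesis using M(2) greedy_set_Suc[OF d mA] m(2) by auto
qed

section \<open>Winning bids and the total payment\<close>

lemma winning_bid_bound:
  assumes c: "cost_vector A c" and \<gamma>: "0 \<le> \<gamma>" "\<gamma> \<le> 1/2" and b: "0 \<le> b"
    and N: "\<And>n. n < N \<Longrightarrow> greedy_tm_cond \<gamma> A B v c (Suc n)" and n: "n < N" "item c n = i"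
    and i: "i \<in> greedy_tm \<gamma> A B v (c(i := b))"
  shows "b * v (greedy_set A v c N) \<le> B * marginal v i (greedy_set A v c n)"
proof -
  let ?d = "c(i := b)"
  define S where "S = greedy_set A v c N"
  define m where "m = marginal v i (greedy_set A v c n)"
  have d: "cost_vector A ?d" using c b by (simp add: cost_vector_upd)
  have nA: "n < card A" using cond_le_card[OF c N[OF n(1)]] .
  have iA: "i \<in> A" and iS: "i \<notin> greedy_set A v c n" using item_in[OF c nA] n(2) by auto
  have m0: "0 \<le> m" unfolding m_def by (intro marginal_nonneg greedy_set_subset c iA)
  have SA: "S \<subseteq> A" unfolding S_def by (rule greedy_set_subset[OF c])
  \<comment> \<open>Here \<open>\<gamma> \<le> 1/2\<close> enters: two bounds of size
    \<open>\<gamma> * B * m\<close> will be added.\<close>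
  have "2 * \<gamma> * (B * m) \<le> 1 * (B * m)"
    using \<gamma> m0 B_pos by (intro mult_right_mono) auto
  then have half: "2 * (\<gamma> * B * m) \<le> B * m" by (simp add: mult_ac)
  have \<gamma>Bm: "0 \<le> \<gamma> * B * m" using \<gamma> m0 B_pos by simp
  show ?thesis
  proof (cases "b \<le> c i")
    case True
    have "b * v S \<le> c i * v S" using True v_nonneg[OF SA] by (rule mult_right_mono)
    also have "\<dots> \<le> \<gamma> * B * m" using winner_cost[OF c N n(1)] n(2) by (simp add: S_def m_def)
    finally show ?thesis using half \<gamma>Bm by (simp add: S_def m_def)
  next
    case False
    have ci: "0 \<le> c i" using c iA by (auto simp: cost_vector_def)
    obtain M where M: "M \<le> card A" "greedy_tm \<gamma> A B v ?d = greedy_set A v ?d M"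
      "\<And>n. n < M \<Longrightarrow> greedy_tm_cond \<gamma> A B v ?d (Suc n)" "\<not> greedy_tm_cond \<gamma> A B v ?d (Suc M)"
      by (rule greedy_tm_stop[OF fin, of \<gamma> B v "?d"]) (rule that)
    obtain l where l: "l < M" "item ?d l = i" "i \<notin> greedy_set A v ?d l"
      using selection_index[OF d _ M(1)] i M(2) by auto
    define T where "T = greedy_set A v ?d l"
    have lA: "l < card A" using l M(1) by simp
    \<comment> \<open>\<open>c\<close> is \<open>?d\<close> with the bid of \<open>i\<close> lowered
      to \<open>c i\<close>, so the two runs agree until \<open>c\<close> selects
      \<open>i\<close>.\<close>
    have same: "greedy_set A v c n = greedy_set A v ?d n"
      using greedy_set_lower[OF d, of "c i" i n] iS ci False by simp
    have "n \<le> l"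
    proof (rule ccontr)
      assume "\<not> n \<le> l"
      then have "greedy_set A v ?d (Suc l) \<subseteq> greedy_set A v ?d n" by (intro greedy_set_mono d) auto
      then show False using iS same greedy_set_Suc[OF d lA] l(2) by auto
    qed
    then have sub: "greedy_set A v c n \<subseteq> T" unfolding same T_def by (intro greedy_set_mono d)
    have TA: "T \<subseteq> A" unfolding T_def by (rule greedy_set_subset[OF d])
    have mT: "marginal v i T \<le> m" unfolding m_def by (intro marginal_antimono sub TA iA)
    have TiA: "T \<union> {i} \<subseteq> A" using TA iA by auto
    have "b * v (T \<union> {i}) \<le> \<gamma> * B * marginal v i T"
      using cond_iff[OF d lA, of \<gamma>] M(3)[OF l(1)] greedy_set_Suc[OF d lA] l(2)
      by (auto simp: T_def simp del: greedy_set.simps(2))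
    also have "\<dots> \<le> \<gamma> * B * m" using mT \<gamma> B_pos by (intro mult_left_mono) auto
    finally have 1: "b * v (T \<union> {i}) \<le> \<gamma> * B * m" .
    have "b * (v S - v (T \<union> {i})) \<le> b * (\<Sum>r\<in>S - (T \<union> {i}). marginal v r (T \<union> {i}))"
      using value_le_marginals[OF TiA SA] b by (intro mult_left_mono) auto
    also have "\<dots> = (\<Sum>r\<in>S - (T \<union> {i}). b * marginal v r (T \<union> {i}))" by (rule sum_distrib_left)
    \<comment> \<open>Each such \<open>r\<close> was still available at \<open>T\<close>, with its
      unchanged cost \<open>c r\<close>, when \<open>i\<close> was selected with bid
      \<open>b\<close>.\<close>
    also have "\<dots> \<le> (\<Sum>r\<in>S - (T \<union> {i}). m * c r)"
    proof (rule sum_mono)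
      fix r assume r: "r \<in> S - (T \<union> {i})"
      then have rA: "r \<in> A - T" and ri: "r \<noteq> i" using SA by auto
      have cr: "0 \<le> c r" using c rA by (auto simp: cost_vector_def)
      have "b * marginal v r (T \<union> {i}) \<le> b * marginal v r T"
        using rA TiA b by (intro mult_left_mono marginal_antimono) auto
      also have "\<dots> \<le> marginal v i T * c r"
        using greedy_next_cross[OF d TA rA] l(2) ri by (simp add: T_def mult.commute)
      also have "\<dots> \<le> m * c r" using mT cr by (rule mult_right_mono)
      finally show "b * marginal v r (T \<union> {i}) \<le> m * c r" .
    qed
    also have "\<dots> = m * sum c (S - (T \<union> {i}))" by (rule sum_distrib_left[symmetric])
    also have "\<dots> \<le> m * sum c S"
      using c SA m0 finite_subset[OF SA fin]
      by (intro mult_left_mono sum_mono2) (auto simp: cost_vector_def)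
    also have "\<dots> \<le> m * (\<gamma> * B)"
      unfolding S_def using n(1) by (intro mult_left_mono m0 winners_cost[OF c N _ \<gamma>(1)]) auto
    finally have "b * v S \<le> 2 * (\<gamma> * B * m)" using 1 by (simp add: algebra_simps)
    with half show ?thesis by (simp add: S_def m_def)
  qed
qed

text \<open>Each winner is paid at most \<open>B\<close> times his share of the winning value, and
  the shares add up to at most 1. The rule \<open>f\<close> is abstract so that the bound serves
  Greedy-TM as well as Random-TM, whose pool of sellers depends on the bids.\<close>

lemma payments_le_budget:
  assumes c: "cost_vector A c" and \<gamma>: "0 \<le> \<gamma>" "\<gamma> \<le> 1/2" and f: "f c = greedy_tm \<gamma> A B v c"
    and dev: "\<And>i b. i \<in> A \<Longrightarrow> 0 \<le> b \<Longrightarrow> i \<in> f (c(i := b)) \<Longrightarrow> i \<in> greedy_tm \<gamma> A B v (c(i := b))"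
  shows "(\<Sum>i\<in>A. threshold_payment f c i) \<le> ereal B"
proof -
  obtain N where N: "N \<le> card A" "greedy_tm \<gamma> A B v c = greedy_set A v c N"
    "\<And>n. n < N \<Longrightarrow> greedy_tm_cond \<gamma> A B v c (Suc n)" "\<not> greedy_tm_cond \<gamma> A B v c (Suc N)"
    by (rule greedy_tm_stop[OF fin, of \<gamma> B v c]) (rule that)
  define S where "S = greedy_set A v c N"
  have SA: "S \<subseteq> A" unfolding S_def by (rule greedy_set_subset[OF c])
  let ?m = "\<lambda>n. marginal v (item c n) (greedy_set A v c n)"
  have pay: "threshold_payment f c (item c n) \<le> ereal (B * ?m n / v S)" if n: "n < N" for n
  proof -
    have inS: "item c n \<in> S" unfolding S_def greedy_set_image[OF c N(1)] using n by auto
    then have xA: "item c n \<in> A" using SA by auto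
    have V: "0 < v S" using v_pos[OF SA inS] .
    have bd: "0 \<le> B * ?m n / v S"
      using V B_pos xA by (intro divide_nonneg_pos mult_nonneg_nonneg marginal_nonneg greedy_set_subset c) auto
    have "threshold_payment f c (item c n) = (INF b\<in>{b. 0 \<le> b \<and> item c n \<notin> f (c(item c n := b))}. ereal b)"
      using inS f N(2) by (simp add: threshold_payment_def S_def)
    also have "\<dots> \<le> ereal (B * ?m n / v S)"
    proof (rule ereal_le_epsilon2)
      \<comment> \<open>No bid above the bound wins, so any slack \<open>e\<close> yields a losing
        bid under the infimum.\<close>
      fix e :: real assume e: "0 < e"
      let ?b = "B * ?m n / v S + e"
      have b0: "0 \<le> ?b" using bd e by simp
      have "item c n \<notin> f (c(item c n := ?b))"
      proof
        assume "item c n \<in> f (c(item c n := ?b))"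
        then have "item c n \<in> greedy_tm \<gamma> A B v (c(item c n := ?b))" by (rule dev[OF xA b0])
        then have "?b * v S \<le> B * ?m n"
          using winning_bid_bound[OF c \<gamma> b0 N(3) n refl] by (simp only: S_def)
        then have "e * v S \<le> 0" using V by (simp add: distrib_right)
        then show False using mult_pos_pos[OF e V] by simp
      qed
      then have "(INF b\<in>{b. 0 \<le> b \<and> item c n \<notin> f (c(item c n := b))}. ereal b) \<le> ereal ?b"
        using b0 by (intro INF_lower) auto
      then show "(INF b\<in>{b. 0 \<le> b \<and> item c n \<notin> f (c(item c n := b))}. ereal b) \<le> ereal (B * ?m n / v S) + ereal e"
        by simp
    qed
    finally show ?thesis .
  qed
  have "(\<Sum>i\<in>A. threshold_payment f c i) = (\<Sum>i\<in>S. threshold_payment f c i)"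
    using fin SA f N(2) by (intro sum.mono_neutral_right) (auto simp: threshold_payment_def S_def)
  also have "\<dots> = (\<Sum>n<N. threshold_payment f c (item c n))"
    unfolding S_def by (rule sum_greedy_set[OF c N(1)])
  also have "\<dots> \<le> (\<Sum>n<N. ereal (B * ?m n / v S))" using pay by (intro sum_mono) auto
  also have "\<dots> = ereal (B * (v S - v {}) / v S)"
    by (simp add: sum_divide_distrib[symmetric] sum_distrib_left[symmetric] sum_marginals[OF c N(1)] S_def)
  also have "\<dots> \<le> ereal B"
  proof -
    have "B * (v S - v {}) \<le> B * v S" using B_pos v_nonneg[of "{}"] by (intro mult_left_mono) auto
    moreover have "0 \<le> v S" by (rule v_nonneg[OF SA])
    \<comment> \<open>\<open>v S = 0\<close> is possible only without winners; the quotient is then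
      0 by convention.\<close>
    ultimately have "B * (v S - v {}) / v S \<le> B"
      using B_pos by (cases "v S = 0") (auto simp: divide_le_eq)
    then show ?thesis by simp
  qed
  finally show ?thesis .
qed

lemma truthful_greedy_tm: "0 \<le> \<gamma> \<Longrightarrow> truthful A (with_thresholds (greedy_tm \<gamma> A B v))"
  by (intro truthful_with_thresholds greedy_tm_mono) auto

lemma budget_feasible_greedy_tm:
  "0 \<le> \<gamma> \<Longrightarrow> \<gamma> \<le> 1/2 \<Longrightarrow> budget_feasible A B (with_thresholds (greedy_tm \<gamma> A B v))"
  unfolding budget_feasible_def with_thresholds_def
  by (auto intro!: payments_le_budget)

lemma greedy_tm_subset: "cost_vector A c \<Longrightarrow> greedy_tm \<gamma> A B v c \<subseteq> A"
  by (rule greedy_tm_stop[OF fin, of \<gamma> B v c]) (simp add: greedy_set_subset)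

section \<open>Approximation guarantee of Greedy-TM\<close>

text \<open>\<open>V\<close> is left open for its two uses: the value of the best affordable seller
  in Random-TM, and a small fraction of the optimum in a large market.\<close>

lemma greedy_tm_approx:
  assumes c: "cost_vector A c" and \<gamma>: "0 < \<gamma>" and W: "W \<subseteq> A" "sum c W \<le> B"
    and V: "0 \<le> V" "\<And>i. i \<in> A \<Longrightarrow> v {i} \<le> V"
  shows "v W \<le> (1 + 1 / \<gamma>) * v (greedy_tm \<gamma> A B v c) + V / \<gamma>"
proof -
  obtain N where N: "N \<le> card A" "greedy_tm \<gamma> A B v c = greedy_set A v c N"
    "\<And>n. n < N \<Longrightarrow> greedy_tm_cond \<gamma> A B v c (Suc n)" "\<not> greedy_tm_cond \<gamma> A B v c (Suc N)"
    by (rule greedy_tm_stop[OF fin, of \<gamma> B v c]) (rule that)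
  define S where "S = greedy_set A v c N"
  have SA: "S \<subseteq> A" unfolding S_def by (rule greedy_set_subset[OF c])
  have S0: "0 \<le> v S" by (rule v_nonneg[OF SA])
  have easy: ?thesis if "v W \<le> v S"
    using that S0 V(1) \<gamma> N(2) by (simp add: S_def distrib_right add_increasing2)
  show ?thesis
  proof (cases "N = card A")
    case True
    then have "S = A" using greedy_set_full[OF c] by (simp add: S_def)
    then show ?thesis using v_mono[OF W(1)] by (intro easy) auto
  next
    case False
    then have NA: "N < card A" using N(1) by simp
    define k where "k = item c N"
    have k: "k \<in> A - S" using item_in[OF c NA] by (simp add: k_def S_def)
    have val: "v W \<le> v S + (\<Sum>r\<in>W - S. marginal v r S)" by (rule value_le_marginals[OF SA W(1)])
    show ?thesis
    proof (cases "marginal v k S = 0")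
      case True
      \<comment> \<open>Greedy-TM also stops at marginal 0; then no remaining item adds anything to
        \<open>S\<close>.\<close>
      have "(\<Sum>r\<in>W - S. marginal v r S) = 0"
        using marginal_eq_0_if_greedy_next_0[OF c SA, folded S_def] True W(1)
        by (intro sum.neutral) (auto simp: k_def S_def)
      then show ?thesis using val by (intro easy) auto
    next
      case False
      then have m: "0 < marginal v k S" using marginal_nonneg[OF SA, of k] k by auto
      have fail: "\<gamma> * B * marginal v k S < c k * v (S \<union> {k})"
        using cond_iff[OF c NA, of \<gamma>] N(4) m greedy_set_Suc[OF c NA]
        by (auto simp: k_def S_def simp del: greedy_set.simps(2))
      have ck0: "0 \<le> c k" using c k by (auto simp: cost_vector_def)
      \<comment> \<open>For \<open>c k = 0\<close> the right side of \<open>fail\<close> would be 0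
        while its left side is positive.\<close>
      have "c k \<noteq> 0" using fail m \<gamma> B_pos by (auto simp: mult_less_0_iff)
      with ck0 have ck: "0 < c k" by simp
      \<comment> \<open>Fractional knapsack bound: no remaining item beats the ratio of
        \<open>k\<close>, so a budget of \<open>B\<close> gains at most
        \<open>B * marginal v k S / c k\<close>.\<close>
      have "c k * (\<Sum>r\<in>W - S. marginal v r S) = (\<Sum>r\<in>W - S. marginal v r S * c k)"
        by (simp add: sum_distrib_left mult.commute)
      also have "\<dots> \<le> (\<Sum>r\<in>W - S. marginal v k S * c r)"
        using W(1) greedy_next_cross[OF c SA] by (intro sum_mono) (auto simp: k_def S_def)
      also have "\<dots> = marginal v k S * sum c (W - S)" by (rule sum_distrib_left[symmetric])
      also have "\<dots> \<le> marginal v k S * sum c W"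
        using m c W(1) finite_subset[OF W(1) fin]
        by (intro mult_left_mono sum_mono2) (auto simp: cost_vector_def)
      also have "\<dots> \<le> marginal v k S * B" using m W(2) by simp
      finally have "\<gamma> * (c k * (\<Sum>r\<in>W - S. marginal v r S)) \<le> \<gamma> * (marginal v k S * B)"
        using \<gamma> by (intro mult_left_mono) auto
      also have "\<dots> \<le> c k * v (S \<union> {k})" using fail by (simp add: mult_ac)
      finally have "c k * (\<gamma> * (\<Sum>r\<in>W - S. marginal v r S)) \<le> c k * v (S \<union> {k})"
        by (simp add: mult_ac)
      then have "\<gamma> * (\<Sum>r\<in>W - S. marginal v r S) \<le> v (S \<union> {k})" using ck by simp
      also have "\<dots> \<le> v S + V"
        using marginal_le_single[OF SA, of k] V(2)[of k] k by (simp add: marginal_def)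
      finally have "(\<Sum>r\<in>W - S. marginal v r S) \<le> (v S + V) / \<gamma>"
        using \<gamma> by (simp add: field_simps)
      then show ?thesis using val N(2) by (simp add: S_def distrib_right add_divide_distrib)
    qed
  qed
qed

section \<open>The optimum and Random-TM\<close>

lemma opt_attained:
  obtains W where "W \<subseteq> A" "sum c W \<le> B" "opt A B v c = v W"
proof -
  have "finite {v S | S. S \<subseteq> A \<and> sum c S \<le> B}"
    using fin by (auto intro: finite_subset[of _ "v ` Pow A"])
  moreover have "v {} \<in> {v S | S. S \<subseteq> A \<and> sum c S \<le> B}"
    using B_pos by (auto intro!: exI[of _ "{}"])
  ultimately have "opt A B v c \<in> {v S | S. S \<subseteq> A \<and> sum c S \<le> B}"
    unfolding opt_def by (intro Max_in) auto
  then show ?thesis using that by auto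
qed

text \<open>Makes all results above available for the pool of sellers who bid at most
  \<open>B\<close>.\<close>

lemma procurement_subset: "A' \<subseteq> A \<Longrightarrow> procurement A' B v"
  unfolding procurement_def procurement_instance_def submodular_on_def mono_on_def
  using finite_subset[OF _ fin] B_pos
  by (auto intro!: v_nonneg v_mono v_sub v_single)

lemma best_single:
  assumes "A \<noteq> {}"
  shows "best_single A v \<in> A" "j \<in> A \<Longrightarrow> v {j} \<le> v {best_single A v}"
proof -
  let ?M = "{i \<in> A. \<forall>j\<in>A. v {j} \<le> v {i}}"
  obtain i where "i \<in> A" "Max ((\<lambda>i. v {i}) ` A) = v {i}"
    using Max_in[of "(\<lambda>i. v {i}) ` A"] fin assms by fastforce
  then have "i \<in> ?M" using fin by (auto simp flip: \<open>Max _ = _\<close>)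
  then have "best_single A v \<in> ?M"
    unfolding best_single_def using fin by (intro Min_in) auto
  then show "best_single A v \<in> A" "j \<in> A \<Longrightarrow> v {j} \<le> v {best_single A v}" by auto
qed

lemma affordable_upd:
  assumes "c i \<le> B" "b \<le> B"
  shows "{j \<in> A. (c(i := b)) j \<le> B} = {j \<in> A. c j \<le> B}"
  using assms by auto

text \<open>Serves to show that a seller of the pool who deviates and still wins has left the pool
  unchanged.\<close>

lemma random_tm_outcome_cost:
  assumes "cost_vector A c" "i \<in> random_tm_outcome \<gamma> A B v coin c"
  shows "i \<in> {j \<in> A. c j \<le> B}"
proof -
  interpret A': procurement "{j \<in> A. c j \<le> B}" B v by (rule procurement_subset) auto
  have "cost_vector {j \<in> A. c j \<le> B} c" using assms by (auto simp: cost_vector_def)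
  then show ?thesis
    using assms A'.greedy_tm_subset[of c \<gamma>] A'.best_single(1)
    by (auto simp: random_tm_outcome_def Let_def split: if_splits)
qed

text \<open>Lowering a winning bid keeps the pool; on a fixed pool Greedy-TM is monotone and
  \<open>best_single\<close> ignores the bids.\<close>

lemma truthful_random_tm_outcome:
  assumes \<gamma>: "0 \<le> \<gamma>"
  shows "truthful A (with_thresholds (random_tm_outcome \<gamma> A B v coin))"
proof (rule truthful_with_thresholds)
  fix c :: "'a \<Rightarrow> real" and i b
  assume c: "cost_vector A c" and i: "i \<in> A" "i \<in> random_tm_outcome \<gamma> A B v coin c"
    and b: "0 \<le> b" "b \<le> c i"
  let ?A = "{j \<in> A. c j \<le> B}"
  interpret A': procurement ?A B v by (rule procurement_subset) auto
  have c': "cost_vector ?A c" using c by (auto simp: cost_vector_def)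
  have ci: "c i \<le> B" using random_tm_outcome_cost[OF c i(2)] by simp
  have "{j \<in> A. (c(i := b)) j \<le> B} = ?A" using ci b by (intro affordable_upd) auto
  then show "i \<in> random_tm_outcome \<gamma> A B v coin (c(i := b))"
    using i(2) A'.greedy_tm_mono[OF c' b \<gamma>]
    unfolding random_tm_outcome_def Let_def by (simp split: if_splits)
qed

lemma budget_feasible_random_tm_outcome:
  assumes \<gamma>: "0 \<le> \<gamma>" "\<gamma> \<le> 1/2"
  shows "budget_feasible A B (with_thresholds (random_tm_outcome \<gamma> A B v coin))"
  unfolding budget_feasible_def with_thresholds_def snd_conv
proof (intro allI impI)
  fix c :: "'a \<Rightarrow> real"
  assume c: "cost_vector A c"
  let ?f = "random_tm_outcome \<gamma> A B v coin" and ?A = "{j \<in> A. c j \<le> B}"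
  interpret A': procurement ?A B v by (rule procurement_subset) auto
  have c': "cost_vector ?A c" using c by (auto simp: cost_vector_def)
  have dev: "b \<le> B \<and> {j \<in> A. (c(i := b)) j \<le> B} = ?A" if "i \<in> ?A" "0 \<le> b" "i \<in> ?f (c(i := b))" for i b
    using that random_tm_outcome_cost[OF cost_vector_upd[OF c that(2)] that(3)] by auto
  have "(\<Sum>i\<in>A. threshold_payment ?f c i) = (\<Sum>i\<in>?A. threshold_payment ?f c i)"
    using fin random_tm_outcome_cost[OF c]
    by (intro sum.mono_neutral_right) (auto simp: threshold_payment_def)
  also have "\<dots> \<le> ereal B"
  proof (cases "?A = {}")
    case True
    then show ?thesis using B_pos by (simp only: sum.empty) simp
  next
    case ne: False
    show ?thesis
    proof (cases coin)
      case True
      show ?thesis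
      proof (rule A'.payments_le_budget[OF c' \<gamma>])
        show "?f c = greedy_tm \<gamma> ?A B v c"
          using ne True by (simp only: random_tm_outcome_def Let_def if_False if_True)
        fix i b assume "i \<in> ?A" "0 \<le> b" "i \<in> ?f (c(i := b))"
        with dev[OF this] True show "i \<in> greedy_tm \<gamma> ?A B v (c(i := b))"
          unfolding random_tm_outcome_def Let_def by (auto split: if_splits)
      qed
    next
      case False
      let ?s = "best_single ?A v"
      have f: "?f c = {?s}" using ne False by (simp only: random_tm_outcome_def Let_def if_False)
      have s: "?s \<in> ?A" by (rule A'.best_single(1)[OF ne])
      have "(\<Sum>i\<in>?A. threshold_payment ?f c i) = (\<Sum>i\<in>{?s}. threshold_payment ?f c i)"
        using fin s f by (intro sum.mono_neutral_right) (auto simp: threshold_payment_def)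
      also have "\<dots> = (INF b\<in>{b. 0 \<le> b \<and> ?s \<notin> ?f (c(?s := b))}. ereal b)"
        using f by (simp add: threshold_payment_def)
      \<comment> \<open>A bid above \<open>B\<close> removes the seller from the pool, so it loses
        and caps the threshold.\<close>
      also have "\<dots> \<le> ereal B"
      proof (rule ereal_le_epsilon2)
        fix e :: real assume e: "0 < e"
        then have "?s \<notin> ?f (c(?s := B + e))"
          using dev[OF s, of "B + e"] B_pos by auto
        then have "(INF b\<in>{b. 0 \<le> b \<and> ?s \<notin> ?f (c(?s := b))}. ereal b) \<le> ereal (B + e)"
          using e B_pos by (intro INF_lower) auto
        then show "(INF b\<in>{b. 0 \<le> b \<and> ?s \<notin> ?f (c(?s := b))}. ereal b) \<le> ereal B + ereal e" by simp
      qed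
      finally show ?thesis .
    qed
  qed
  finally show "(\<Sum>i\<in>A. threshold_payment ?f c i) \<le> ereal B" .
qed

text \<open>Scaled by \<open>1 + 2 / \<gamma>\<close>, the probabilities of the coin become exactly
  the coefficients \<open>1 + 1 / \<gamma>\<close> and \<open>1 / \<gamma>\<close> of
  \<open>greedy_tm_approx\<close>.\<close>

lemma random_tm_approx:
  assumes c: "cost_vector A c" and \<gamma>: "0 < \<gamma>"
  shows "opt A B v c \<le>
    (1 + 2 / \<gamma>) * expected_value v (map_pmf with_thresholds (random_tm \<gamma> A B v)) c"
proof -
  let ?A = "{j \<in> A. c j \<le> B}"
  let ?f = "\<lambda>coin. random_tm_outcome \<gamma> A B v coin c"
  interpret A': procurement ?A B v by (rule procurement_subset) auto
  have c': "cost_vector ?A c" using c by (auto simp: cost_vector_def)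
  define p where "p = (\<gamma> + 1) / (\<gamma> + 2)"
  have "1 + 2 / \<gamma> = (\<gamma> + 2) / \<gamma>" "1 - p = 1 / (\<gamma> + 2)" "1 + 1 / \<gamma> = (\<gamma> + 1) / \<gamma>"
    using \<gamma> by (simp_all add: p_def field_simps)
  then have p: "0 \<le> p" "p \<le> 1" "(1 + 2 / \<gamma>) * p = 1 + 1 / \<gamma>" "(1 + 2 / \<gamma>) * (1 - p) = 1 / \<gamma>"
    using \<gamma> by (simp_all add: p_def)
  have "expected_value v (map_pmf with_thresholds (random_tm \<gamma> A B v)) c
      = p * v (?f True) + (1 - p) * v (?f False)"
    using p(1,2)
    by (simp add: expected_value_def random_tm_def with_thresholds_def p_def[symmetric])
  then have ev: "(1 + 2 / \<gamma>) * expected_value v (map_pmf with_thresholds (random_tm \<gamma> A B v)) c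
      = (1 + 1 / \<gamma>) * v (?f True) + v (?f False) / \<gamma>"
    using p(3,4) by (simp add: distrib_left mult.assoc[symmetric])
  obtain W where W: "W \<subseteq> A" "sum c W \<le> B" "opt A B v c = v W" by (rule opt_attained)
  \<comment> \<open>A set within the budget has only affordable members, so the optimum survives the
    removal of the others.\<close>
  have "c i \<le> B" if "i \<in> W" for i
    using member_le_sum[OF that, of c] W c finite_subset[OF W(1) fin]
    by (fastforce simp: cost_vector_def)
  then have W': "W \<subseteq> ?A" using W(1) by auto
  show ?thesis
  proof (cases "?A = {}")
    case True
    then have "?f coin = {}" for coin unfolding random_tm_outcome_def Let_def by simp
    moreover have "W = {}" using W' unfolding True by simp
    \<comment> \<open>Both sides are multiples of \<open>v {}\<close>, which may be positive; the
      factor on the right is at least 1.\<close>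
    ultimately show ?thesis
      unfolding ev W(3) using v_nonneg[of "{}"] \<gamma> by (simp add: distrib_right)
  next
    case False
    then have f: "?f True = greedy_tm \<gamma> ?A B v c" "?f False = {best_single ?A v}"
      by (simp_all only: random_tm_outcome_def Let_def if_False if_True)
    have "v W \<le> (1 + 1 / \<gamma>) * v (greedy_tm \<gamma> ?A B v c) + v {best_single ?A v} / \<gamma>"
      by (intro A'.greedy_tm_approx[OF c' \<gamma> W' W(2)] A'.v_nonneg A'.best_single(2)[OF False])
        (use A'.best_single(1)[OF False] in auto)
    then show ?thesis unfolding ev W(3) f .
  qed
qed

end

section \<open>The ratios 5 and 3 for \<gamma> = 1/2\<close>

theorem corollary3p5:
  shows
    "(\<forall>(A :: 'a::linorder set) B v. procurement_instance A B v \<longrightarrow>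
        (let R = map_pmf with_thresholds (random_tm (1/2) A B v) in
           universally_truthful A R \<and>
           universally_budget_feasible A B R \<and>
           (\<forall>c. cost_vector A c \<longrightarrow> 5 * expected_value v R c \<ge> opt A B v c)))
     \<and>
     (\<forall>(A :: 'a set) B v. procurement_instance A B v \<longrightarrow>
        (let M = with_thresholds (greedy_tm (1/2) A B v) in
           truthful A M \<and> budget_feasible A B M))
     \<and>
     (\<forall>\<epsilon>>0. \<exists>\<theta>\<^sub>0>0. \<forall>(A :: 'a set) B v c.
        procurement_instance A B v \<longrightarrow> A \<noteq> {} \<longrightarrow> cost_vector A c \<longrightarrow>
        opt A B v c > 0 \<longrightarrow> market_theta A B v c \<le> \<theta>\<^sub>0 \<longrightarrow>
        (3 + \<epsilon>) * v (greedy_tm (1/2) A B v c) \<ge> opt A B v c)"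
proof (intro conjI allI impI)
  fix A :: "'a set" and B v
  assume "procurement_instance A B v"
  then interpret procurement A B v by unfold_locales
  have "5 * expected_value v (map_pmf with_thresholds (random_tm (1/2) A B v)) c \<ge> opt A B v c"
    if "cost_vector A c" for c
    using random_tm_approx[OF that, of "1/2"] by simp
  moreover have "universally_truthful A (map_pmf with_thresholds (random_tm (1/2) A B v))"
    using truthful_random_tm_outcome[of "1/2"] by (auto simp: universally_truthful_def random_tm_def)
  moreover have "universally_budget_feasible A B (map_pmf with_thresholds (random_tm (1/2) A B v))"
    using budget_feasible_random_tm_outcome[of "1/2"]
    by (auto simp: universally_budget_feasible_def random_tm_def)
  ultimately show "let R = map_pmf with_thresholds (random_tm (1/2) A B v) in
           universally_truthful A R \<and>
           universally_budget_feasible A B R \<and>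
           (\<forall>c. cost_vector A c \<longrightarrow> 5 * expected_value v R c \<ge> opt A B v c)"
    unfolding Let_def by blast
next
  fix A :: "'a set" and B v
  assume "procurement_instance A B v"
  then interpret procurement A B v by unfold_locales
  show "let M = with_thresholds (greedy_tm (1/2) A B v) in truthful A M \<and> budget_feasible A B M"
    unfolding Let_def using truthful_greedy_tm budget_feasible_greedy_tm by simp
next
  fix \<epsilon> :: real assume \<epsilon>: "0 < \<epsilon>"
  \<comment> \<open>Solves \<open>(3 + \<epsilon>) * (1 - 2 * \<theta>) = 3\<close>; the factor
    \<open>1 - 2 * \<theta>\<close> appears when the loss \<open>V / \<gamma>\<close>, with
    \<open>V\<close> equal to \<theta> times the optimum, moves to the side of the optimum.\<close>
  define \<theta> where "\<theta> = \<epsilon> / (2 * (3 + \<epsilon>))"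
  have \<theta>: "0 < \<theta>" "(3 + \<epsilon>) * (1 - 2 * \<theta>) = 3" using \<epsilon> by (simp_all add: \<theta>_def field_simps)
  have "(3 + \<epsilon>) * v (greedy_tm (1/2) A B v c) \<ge> opt A B v c"
    if inst: "procurement_instance A B v" and "A \<noteq> {}" and c: "cost_vector A c"
      and opt: "opt A B v c > 0" and large: "market_theta A B v c \<le> \<theta>"
    for A :: "'a set" and B v c
  proof -
    interpret procurement A B v using inst by unfold_locales
    let ?o = "opt A B v c" and ?g = "v (greedy_tm (1/2) A B v c)"
    have Max: "Max ((\<lambda>i. v {i}) ` A) \<le> \<theta> * ?o"
      using large opt by (simp add: market_theta_def divide_le_eq)
    have small: "v {i} \<le> \<theta> * ?o" if "i \<in> A" for i
      using that fin by (intro order_trans[OF Max_ge Max]) auto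
    obtain W where W: "W \<subseteq> A" "sum c W \<le> B" "?o = v W" by (rule opt_attained)
    have "v W \<le> (1 + 1 / (1/2)) * ?g + \<theta> * ?o / (1/2)"
      using \<theta>(1) opt by (intro greedy_tm_approx[OF c _ W(1,2)] small) auto
    then have "(1 - 2 * \<theta>) * ?o \<le> 3 * ?g" using W(3) by (simp add: algebra_simps)
    then have "(3 + \<epsilon>) * ((1 - 2 * \<theta>) * ?o) \<le> (3 + \<epsilon>) * (3 * ?g)"
      using \<epsilon> by (intro mult_left_mono) auto
    moreover have "(3 + \<epsilon>) * ((1 - 2 * \<theta>) * ?o) = 3 * ?o"
      using \<theta>(2) by (metis mult.assoc)
    ultimately show ?thesis by simp
  qed
  then show "\<exists>\<theta>\<^sub>0>0. \<forall>(A :: 'a set) B v c.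
        procurement_instance A B v \<longrightarrow> A \<noteq> {} \<longrightarrow> cost_vector A c \<longrightarrow>
        opt A B v c > 0 \<longrightarrow> market_theta A B v c \<le> \<theta>\<^sub>0 \<longrightarrow>
        (3 + \<epsilon>) * v (greedy_tm (1/2) A B v c) \<ge> opt A B v c"
    using \<theta>(1) by blast
qed

end
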